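(* Let $\Gamma$ range over finite simple connected graphs. Then $$\limsup_{N_\Gamma\to\infty,\ \Gamma\text{ connected}} h(\Gamma)\ \ge\ \log\left(\frac{3+\sqrt5}{8}\right),$$ that is, $\lim_{k\to\infty}\sup\{h(\Gamma):\Gamma\text{ connected},\ N_\Gamma\ge k\}\ge\log\frac{3+\sqrt5}{8}$.
   Context: Let $\Gamma$ be a finite graph without loops or multiple edges, with vertex set $V(\Gamma)$, edge set $E(\Gamma)$, and $N_\Gamma=|E(\Gamma)|$. Let $I_\Gamma\subset V(\Gamma)\times E(\Gamma)$ be the set of pairs $(v,e)$ with $v$ an endpoint of $e$ (so $|I_\Gamma|=2N_\Gamma$). An orientation prescription is a function $\omega:I_\Gamma\to\{\pm1\}$; it orients each edge of the barycentric subdivision of $\Gamma$ (whose edges join a vertex $v$ to the midpoint $b_e$ of an incident edge $e$): the edge is oriented $b_e\to v$ if $\omega(v,e)=1$, and $v\to b_e$ if $\omega(v,e)=-1$. The prescription $\omega$ is a combinatorial flow if every vertex $v\in V(\Gamma)$ has at most one outgoing edge and every midpoint $b_e$ has at most one incoming edge; equivalently, for each $v$ there is at most one $e$ with $\omega(v,e)=-1$, and for each $e$ there is at most one $v$ with $\omega(v,e)=-1$. Let $P(\Gamma)$ be the probability that a uniformly random orientation prescription is a combinatorial flow, i.e. $P(\Gamma)=4^{-N_\Gamma}\cdot\#\{\text{combinatorial flows on }\Gamma\}$. Define $h(\Gamma)=\frac{\log P(\Gamma)}{N_\Gamma}$ if $E(\Gamma)\ne\emptyset$ and $h(\Gamma)=0$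 otherwise. *)

theory Defs
  imports
    "HOL-Probability.Probability_Mass_Function"
    "Graph_Theory.Pair_Digraph"
    "Graph_Theory.Digraph_Component"
begin

text \<open>
  A finite simple graph is a \<open>pair_graph\<close>, i.e. a finite, symmetric, irreflexive set of arcs.
  Each undirected edge corresponds to two opposite arcs \<open>(u, v)\<close> and \<open>(v, u)\<close>, so the edges
  (and the edge number) are taken from the two-element sets \<open>{u, v}\<close>, not from the arcs.
\<close>

definition edge_set :: "'v pair_pre_digraph \<Rightarrow> 'v set set" where
  "edge_set G = {{u, v} | u v. (u, v) \<in> parcs G}"

definition num_edges :: "'v pair_pre_digraph \<Rightarrow> nat" where
  "num_edges G = card (edge_set G)"

definition incidences :: "'v pair_pre_digraph \<Rightarrow> ('v \<times> 'v set) set" where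
  "incidences G = {(v, e). v \<in> pverts G \<and> e \<in> edge_set G \<and> v \<in> e}"

text \<open>\<open>PiE\<close> makes prescriptions \<open>undefined\<close> off the incidences, so each is counted once.\<close>

definition prescriptions :: "'v pair_pre_digraph \<Rightarrow> ('v \<times> 'v set \<Rightarrow> int) set" where
  "prescriptions G = PiE (incidences G) (\<lambda>_. {1, -1})"

text \<open>\<open>Inl v\<close> is the vertex \<open>v\<close>, \<open>Inr e\<close> the midpoint of the edge \<open>e\<close>.\<close>

definition oriented_subdivision ::
    "'v pair_pre_digraph \<Rightarrow> ('v \<times> 'v set \<Rightarrow> int) \<Rightarrow> ('v + 'v set) pair_pre_digraph" where
  "oriented_subdivision G \<omega> =
     \<lparr> pverts = Inl ` pverts G \<union> Inr ` edge_set G,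
       parcs = {(Inr e, Inl v) | v e. (v, e) \<in> incidences G \<and> \<omega> (v, e) = 1}
             \<union> {(Inl v, Inr e) | v e. (v, e) \<in> incidences G \<and> \<omega> (v, e) = -1} \<rparr>"

definition combinatorial_flow :: "'v pair_pre_digraph \<Rightarrow> ('v \<times> 'v set \<Rightarrow> int) \<Rightarrow> bool" where
  "combinatorial_flow G \<omega> \<longleftrightarrow> \<omega> \<in> prescriptions G
     \<and> (\<forall>v \<in> pverts G. out_degree (with_proj (oriented_subdivision G \<omega>)) (Inl v) \<le> 1)
     \<and> (\<forall>e \<in> edge_set G. in_degree (with_proj (oriented_subdivision G \<omega>)) (Inr e) \<le> 1)"

definition flow_prob :: "'v pair_pre_digraph \<Rightarrow> real" where
  "flow_prob G = measure_pmf.prob (pmf_of_set (prescriptions G)) {\<omega>. combinatorial_flow G \<omega>}"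

definition h :: "'v pair_pre_digraph \<Rightarrow> real" where
  "h G = (if edge_set G \<noteq> {} then ln (flow_prob G) / real (num_edges G) else 0)"

context pair_graph
begin

lemma edge_setE:
  assumes "e \<in> edge_set G"
  obtains u v where "e = {u, v}" "u \<noteq> v" "u \<in> pverts G" "v \<in> pverts G" "(u, v) \<in> parcs G"
proof -
  from assms obtain u v where uv: "e = {u, v}" "(u, v) \<in> parcs G"
    by (auto simp: edge_set_def)
  from uv(2) have "u \<noteq> v" "u \<in> pverts G" "v \<in> pverts G"
    using pair_no_loops arc_fst_in_verts arc_snd_in_verts by fastforce+
  with uv that show ?thesis by blast
qed

lemma finite_edge_set: "finite (edge_set G)"
proof -
  have "edge_set G = (\<lambda>(u, v). {u, v}) ` parcs G"
    by (auto simp: edge_set_def)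
  then show ?thesis by (simp add: pair_finite_arcs)
qed

lemma incidences_Sigma: "incidences G = (\<lambda>(e, v). (v, e)) ` (SIGMA e:edge_set G. e)"
proof -
  have "v \<in> pverts G" if "e \<in> edge_set G" "v \<in> e" for v e
    using that by (auto elim: edge_setE)
  then show ?thesis by (auto simp: incidences_def image_iff)
qed

lemma finite_incidences: "finite (incidences G)"
  unfolding incidences_Sigma
  by (intro finite_imageI finite_SigmaI finite_edge_set) (auto elim: edge_setE)

lemma card_incidences: "card (incidences G) = 2 * num_edges G"
proof -
  have "card (incidences G) = card (SIGMA e:edge_set G. e)"
    unfolding incidences_Sigma by (rule card_image) (auto simp: inj_on_def)
  also have "\<dots> = (\<Sum>e\<in>edge_set G. card e)"
    by (rule card_SigmaI) (use finite_edge_set in \<open>auto elim: edge_setE\<close>)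
  also have "\<dots> = (\<Sum>e\<in>edge_set G. 2)"
    by (rule sum.cong) (auto elim!: edge_setE)
  finally show ?thesis by (simp add: num_edges_def)
qed

lemma finite_prescriptions: "finite (prescriptions G)"
  unfolding prescriptions_def by (intro finite_PiE finite_incidences) auto

lemma prescriptions_nonempty: "prescriptions G \<noteq> {}"
  unfolding prescriptions_def by (simp add: PiE_eq_empty_iff)

lemma card_prescriptions: "card (prescriptions G) = 4 ^ num_edges G"
proof -
  have "card {1, -1 :: int} = 2" by simp
  then have "card (prescriptions G) = 2 ^ (2 * num_edges G)"
    unfolding prescriptions_def by (simp only: card_PiE finite_incidences prod_constant card_incidences)
  then show ?thesis by (simp add: power_mult)
qed

lemma flow_prob_eq: "flow_prob G = real (card {\<omega>. combinatorial_flow G \<omega>}) / 4 ^ num_edges G"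
proof -
  have "prescriptions G \<inter> {\<omega>. combinatorial_flow G \<omega>} = {\<omega>. combinatorial_flow G \<omega>}"
    by (auto simp: combinatorial_flow_def)
  then show ?thesis
    unfolding flow_prob_def
    by (simp add: measure_pmf_of_set finite_prescriptions prescriptions_nonempty card_prescriptions)
qed

lemma combinatorial_flow_iff:
  "combinatorial_flow G \<omega> \<longleftrightarrow> \<omega> \<in> prescriptions G
     \<and> (\<forall>v \<in> pverts G. card {e. (v, e) \<in> incidences G \<and> \<omega> (v, e) = -1} \<le> 1)
     \<and> (\<forall>e \<in> edge_set G. card {v. (v, e) \<in> incidences G \<and> \<omega> (v, e) = -1} \<le> 1)"
proof -
  have out: "out_arcs (with_proj (oriented_subdivision G \<omega>)) (Inl v)
      = (\<lambda>e. (Inl v, Inr e)) ` {e. (v, e) \<in> incidences G \<and> \<omega> (v, e) = -1}" for v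
    by (auto simp: out_arcs_def oriented_subdivision_def)
  have inn: "in_arcs (with_proj (oriented_subdivision G \<omega>)) (Inr e)
      = (\<lambda>v. (Inl v, Inr e)) ` {v. (v, e) \<in> incidences G \<and> \<omega> (v, e) = -1}" for e
    by (auto simp: in_arcs_def oriented_subdivision_def)
  show ?thesis
    unfolding combinatorial_flow_def out_degree_def in_degree_def out inn
    by (subst card_image, simp add: inj_on_def)+ simp
qed

end

end

theory Submission
  imports Defs
begin

text \<open>
  Combinatorial flows are matchings of the barycentric subdivision: the incidences with value
  \<open>-1\<close>. The subdivision of the path with \<open>n\<close> edges is a path with \<open>2 * n\<close> edges, whose matchings
  are the subsets of \<open>{..<2 * n}\<close> without consecutive elements. They are counted by a Fibonacci
  number that is at least \<open>\<phi> ^ (2 * n)\<close> for the golden ratio \<open>\<phi>\<close>. As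
  \<open>\<phi>\<^sup>2 / 4 = (3 + sqrt 5) / 8\<close>, already \<open>h\<close> of each single path reaches the bound.
\<close>

definition sparse_sets :: "nat \<Rightarrow> nat set set" where
  "sparse_sets m = {S. S \<subseteq> {..<m} \<and> (\<forall>j\<in>S. Suc j \<notin> S)}"

lemma finite_sparse_sets: "finite (sparse_sets m)"
  unfolding sparse_sets_def by (rule finite_subset[of _ "Pow {..<m}"]) auto

text \<open>A sparse set below \<open>Suc (Suc m)\<close> either avoids the top element
  \<open>Suc m\<close>, or contains it and hence omits \<open>m\<close>. Removing the top element in
  the second case leaves a sparse set below \<open>m\<close>. A lower bound suffices, so only the
  inclusion of the disjoint union is shown.\<close>

lemma card_sparse_sets_Suc_Suc:
  "card (sparse_sets (Suc (Suc m))) \<ge> card (sparse_sets (Suc m)) + card (sparse_sets m)"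
proof -
  let ?B = "insert (Suc m) ` sparse_sets m"
  have "inj_on (insert (Suc m)) (sparse_sets m)"
    by (rule inj_onI, rule insert_ident[THEN iffD1, rotated 2]) (auto simp: sparse_sets_def)
  then have "card ?B = card (sparse_sets m)"
    by (rule card_image)
  moreover have "sparse_sets (Suc m) \<inter> ?B = {}"
    by (auto simp: sparse_sets_def)
  ultimately have "card (sparse_sets (Suc m)) + card (sparse_sets m)
      = card (sparse_sets (Suc m) \<union> ?B)"
    by (simp add: card_Un_disjoint finite_sparse_sets)
  also have "\<dots> \<le> card (sparse_sets (Suc (Suc m)))"
    by (rule card_mono[OF finite_sparse_sets]) (force simp: sparse_sets_def less_Suc_eq)
  finally show ?thesis .
qed

lemma golden_ratio_power_le_card_sparse_sets:
  "((1 + sqrt 5) / 2) ^ m \<le> real (card (sparse_sets m))"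
proof (induction m rule: induct_nat_012)
  case 0
  have "sparse_sets 0 = {{}}" by (auto simp: sparse_sets_def)
  then show ?case by simp
next
  case 1
  \<comment> \<open>This says that the golden ratio is at most 2, the number of sparse subsets of
    \<open>{..<1}\<close>.\<close>
  have "sqrt 5 \<le> 3" by (rule real_le_lsqrt) auto
  moreover have "sparse_sets (Suc 0) = {{}, {0}}" by (auto simp: sparse_sets_def)
  ultimately show ?case by simp
next
  case (ge2 m)
  \<comment> \<open>By this identity the powers of the golden ratio satisfy the Fibonacci
    recurrence.\<close>
  have "((1 + sqrt 5) / 2)\<^sup>2 = (1 + sqrt 5) / 2 + 1"
    by (simp add: power2_eq_square field_simps)
  then have "((1 + sqrt 5) / 2) ^ Suc (Suc m)
      = ((1 + sqrt 5) / 2) ^ Suc m + ((1 + sqrt 5) / 2) ^ m"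
    by (simp only: power_Suc power2_eq_square mult.assoc[symmetric]) (simp only: distrib_right mult_1)
  also have "\<dots> \<le> real (card (sparse_sets (Suc (Suc m))))"
    using ge2 card_sparse_sets_Suc_Suc[of m] by linarith
  finally show ?case .
qed

definition path_graph :: "nat \<Rightarrow> nat pair_pre_digraph" where
  "path_graph n = \<lparr> pverts = {..n},
     parcs = (\<lambda>i. (i, Suc i)) ` {..<n} \<union> (\<lambda>i. (Suc i, i)) ` {..<n} \<rparr>"

lemma pverts_path_graph [simp]: "pverts (path_graph n) = {..n}"
  by (simp add: path_graph_def)

lemma pair_graph_path_graph: "pair_graph (path_graph n)"
  by unfold_locales (auto simp: path_graph_def symmetric_def intro!: symI)

lemma connected_path_graph: "Digraph_Component.connected (with_proj (path_graph n))"
proof -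
  interpret pair_graph "path_graph n" by (rule pair_graph_path_graph)
  have from_0: "0 \<rightarrow>\<^sup>*\<^bsub>with_proj (path_graph n)\<^esub> v" if "v \<le> n" for v
    using that
  proof (induction v)
    case (Suc v)
    then have "v \<rightarrow>\<^bsub>with_proj (path_graph n)\<^esub> Suc v"
      by (auto simp: path_graph_def)
    with Suc show ?case by (auto intro: reachable_adj_trans)
  qed simp
  have "u \<rightarrow>\<^sup>*\<^bsub>with_proj (path_graph n)\<^esub> v" if "u \<le> n" "v \<le> n" for u v
    \<comment> \<open>Arcs come in opposite pairs, so the walk from 0 to \<open>u\<close> can be
      reversed and continued to \<open>v\<close>.\<close>
    using symmetric_reachable[OF pair_sym_arcs from_0[OF that(1)]] from_0[OF that(2)]
    by (rule reachable_trans)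
  then show ?thesis
    unfolding connected_def strongly_connected_def
    by (auto intro: reachable_mk_symmetricI)
qed

lemma edge_set_path_graph: "edge_set (path_graph n) = (\<lambda>i. {i, Suc i}) ` {..<n}"
  by (auto simp: edge_set_def path_graph_def image_iff)

lemma num_edges_path_graph: "num_edges (path_graph n) = n"
proof -
  have "inj_on (\<lambda>i. {i, Suc i}) {..<n}" by (auto simp: inj_on_def doubleton_eq_iff)
  then show ?thesis by (simp add: num_edges_def edge_set_path_graph card_image)
qed

text \<open>The \<open>j\<close>-th edge of the subdivided path, counted from the end \<open>0\<close>.\<close>

definition path_incidence :: "nat \<Rightarrow> nat \<times> nat set" where
  "path_incidence j = (Suc j div 2, {j div 2, Suc (j div 2)})"

text \<open>The edge determines \<open>j div 2\<close> and the vertex is \<open>Suc j div 2\<close>;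
  these are \<open>j / 2\<close> rounded down and up, and their sum is \<open>j\<close>.\<close>

lemma inj_path_incidence: "inj path_incidence"
proof (rule injI)
  fix j k assume "path_incidence j = path_incidence k"
  then have "j div 2 = k div 2" "Suc j div 2 = Suc k div 2"
    by (auto simp: path_incidence_def doubleton_eq_iff)
  moreover have "i = i div 2 + Suc i div 2" for i :: nat
    by presburger
  ultimately show "j = k" by metis
qed

lemma incidences_path_graph: "incidences (path_graph n) = path_incidence ` {..<2 * n}"
proof (intro equalityI subsetI)
  fix x assume "x \<in> incidences (path_graph n)"
  then obtain i where "i < n" "x = (i, {i, Suc i}) \<or> x = (Suc i, {i, Suc i})"
    by (auto simp: incidences_def edge_set_path_graph)
  \<comment> \<open>Even positions belong to the lower endpoint of an edge, odd ones to the upper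
    endpoint.\<close>
  then have "x = path_incidence (2 * i) \<or> x = path_incidence (Suc (2 * i))" "i < n"
    by (auto simp: path_incidence_def)
  then show "x \<in> path_incidence ` {..<2 * n}" by auto
next
  fix x assume "x \<in> path_incidence ` {..<2 * n}"
  then obtain j where j: "j < 2 * n" "x = path_incidence j" by auto
  then have "j div 2 < n" "Suc j div 2 \<le> n" "Suc j div 2 = j div 2 \<or> Suc j div 2 = Suc (j div 2)"
    by presburger+
  then show "x \<in> incidences (path_graph n)"
    by (auto simp: j incidences_def edge_set_path_graph path_incidence_def)
qed

text \<open>A sparse set is sent to the prescription that is -1 exactly at its positions. Distinct
  incidences sharing a vertex or an edge sit at consecutive positions, so a sparse set selects at
  most one of them.\<close>

lemma card_sparse_sets_le_card_flows:
  "card (sparse_sets (2 * n)) \<le> card {\<omega>. combinatorial_flow (path_graph n) \<omega>}"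
proof (rule card_inj_on_le)
  interpret pair_graph "path_graph n" by (rule pair_graph_path_graph)
  let ?flow = "\<lambda>S. \<lambda>x\<in>incidences (path_graph n). if x \<in> path_incidence ` S then - 1 else 1 :: int"
  have support: "x \<in> incidences (path_graph n) \<and> ?flow S x = -1 \<longleftrightarrow> x \<in> path_incidence ` S"
    if "S \<in> sparse_sets (2 * n)" for S x
    using that by (auto simp: sparse_sets_def incidences_path_graph)
  show "inj_on ?flow (sparse_sets (2 * n))"
  proof (rule inj_onI)
    fix S T assume "S \<in> sparse_sets (2 * n)" "T \<in> sparse_sets (2 * n)" and eq: "?flow S = ?flow T"
    then have "x \<in> path_incidence ` S \<longleftrightarrow> x \<in> path_incidence ` T" for x
      using support[of S x] support[of T x] unfolding eq by blast
    then have "path_incidence ` S = path_incidence ` T" by blast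
    then show "S = T" by (simp only: inj_image_eq_iff[OF inj_path_incidence])
  qed
  show "finite {\<omega>. combinatorial_flow (path_graph n) \<omega>}"
    by (rule finite_subset[OF _ finite_prescriptions]) (auto simp: combinatorial_flow_def)
  show "?flow ` sparse_sets (2 * n) \<subseteq> {\<omega>. combinatorial_flow (path_graph n) \<omega>}"
  proof (intro image_subsetI CollectI)
    fix S assume S: "S \<in> sparse_sets (2 * n)"
    then have fin: "finite (path_incidence ` S)"
      by (auto simp: sparse_sets_def intro: finite_subset)
    have sparse: "j = k" if "j \<in> S" "k \<in> S" "j \<le> Suc k" "k \<le> Suc j" for j k
    proof -
      from that have "j = k \<or> j = Suc k \<or> k = Suc j" by linarith
      with that S show ?thesis by (auto simp: sparse_sets_def)
    qed
    have "card {e. (v, e) \<in> path_incidence ` S} \<le> 1" for v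
    proof -
      have "e = e'" if "(v, e) \<in> path_incidence ` S" "(v, e') \<in> path_incidence ` S" for e e'
      proof -
        from that obtain j k where jk: "j \<in> S" "k \<in> S" "(v, e) = path_incidence j"
          "(v, e') = path_incidence k" by blast
        \<comment> \<open>A common vertex forces equal halves rounded up, hence positions at
          distance at most 1. For a common edge the halves rounded down play this role.\<close>
        then have "Suc j div 2 = Suc k div 2" by (simp add: path_incidence_def)
        then have "j \<le> Suc k" "k \<le> Suc j" by presburger+
        with jk sparse show ?thesis by (metis prod.inject)
      qed
      moreover have "finite {e. (v, e) \<in> path_incidence ` S}"
        using finite_vimageI[OF fin, of "Pair v"] by (simp add: vimage_def inj_def)
      ultimately show ?thesis by (auto simp: card_le_Suc0_iff_eq)
    qed
    moreover have "card {v. (v, e) \<in> path_incidence ` S} \<le> 1" for e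
    proof -
      have "v = v'" if "(v, e) \<in> path_incidence ` S" "(v', e) \<in> path_incidence ` S" for v v'
      proof -
        from that obtain j k where jk: "j \<in> S" "k \<in> S" "(v, e) = path_incidence j"
          "(v', e) = path_incidence k" by blast
        then have "j div 2 = k div 2" by (auto simp: path_incidence_def doubleton_eq_iff)
        then have "j \<le> Suc k" "k \<le> Suc j" by presburger+
        with jk sparse show ?thesis by (metis prod.inject)
      qed
      moreover have "finite {v. (v, e) \<in> path_incidence ` S}"
        using finite_vimageI[OF fin, of "\<lambda>v. (v, e)"] by (simp add: vimage_def inj_def)
      ultimately show ?thesis by (auto simp: card_le_Suc0_iff_eq)
    qed
    moreover have "?flow S \<in> prescriptions (path_graph n)"
      by (auto simp: prescriptions_def)
    ultimately show "combinatorial_flow (path_graph n) (?flow S)"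
      unfolding combinatorial_flow_iff support[OF S] by blast
  qed
qed

lemma h_path_graph_ge:
  assumes "n > 0"
  shows "h (path_graph n) \<ge> ln ((3 + sqrt 5) / 8)"
proof -
  interpret pair_graph "path_graph n" by (rule pair_graph_path_graph)
  have "((1 + sqrt 5) / 2)\<^sup>2 / 4 = (3 + sqrt 5) / 8"
    by (simp add: power2_eq_square field_simps)
  then have "((3 + sqrt 5) / 8) ^ n = ((1 + sqrt 5) / 2) ^ (2 * n) / 4 ^ n"
    by (metis power_divide power_mult)
  also have "\<dots> \<le> real (card (sparse_sets (2 * n))) / 4 ^ n"
    by (intro divide_right_mono golden_ratio_power_le_card_sparse_sets) simp
  also have "\<dots> \<le> flow_prob (path_graph n)"
    unfolding flow_prob_eq num_edges_path_graph
    by (intro divide_right_mono of_nat_mono card_sparse_sets_le_card_flows) simp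
  finally have "((3 + sqrt 5) / 8) ^ n \<le> flow_prob (path_graph n)" .
  moreover have pos: "(3 + sqrt 5) / 8 > 0" by (simp add: add_pos_nonneg)
  ultimately have "ln (((3 + sqrt 5) / 8) ^ n) \<le> ln (flow_prob (path_graph n))"
    by (meson ln_mono zero_less_power)
  then have "real n * ln ((3 + sqrt 5) / 8) \<le> ln (flow_prob (path_graph n))"
    using pos by (simp add: ln_realpow)
  \<comment> \<open>Since \<open>n > 0\<close>, the edge set is nonempty: \<open>h\<close> takes its
    logarithmic branch and division by \<open>n\<close> is legitimate.\<close>
  with assms show ?thesis
    by (auto simp: h_def edge_set_path_graph num_edges_path_graph field_simps)
qed

theorem mainTheorem3:
  shows "\<exists>L :: ereal.
    (\<lambda>k. SUP \<Gamma> \<in> {\<Gamma> :: nat pair_pre_digraph.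
            pair_graph \<Gamma> \<and> Digraph_Component.connected (with_proj \<Gamma>) \<and> num_edges \<Gamma> \<ge> k}. ereal (h \<Gamma>))
      \<longlonglongrightarrow> L
    \<and> L \<ge> ereal (ln ((3 + sqrt 5) / 8))"
proof (intro exI conjI)
  let ?A = "\<lambda>k. {\<Gamma> :: nat pair_pre_digraph.
    pair_graph \<Gamma> \<and> Digraph_Component.connected (with_proj \<Gamma>) \<and> num_edges \<Gamma> \<ge> k}"
  let ?s = "\<lambda>k. SUP \<Gamma> \<in> ?A k. ereal (h \<Gamma>)"
  \<comment> \<open>The index sets shrink as \<open>k\<close> grows, so the suprema decrease and
    converge in \<open>ereal\<close> to their infimum, which is the witness for
    \<open>L\<close>.\<close>
  have "decseq ?s"
    by (intro decseq_SucI SUP_subset_mono) auto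
  then show "?s \<longlonglongrightarrow> (INF k. ?s k)"
    by (rule LIMSEQ_INF)
  show "ereal (ln ((3 + sqrt 5) / 8)) \<le> (INF k. ?s k)"
  proof (rule INF_greatest)
    fix k
    \<comment> \<open>Taking \<open>Suc k\<close> edges ensures at least one edge even for
      \<open>k = 0\<close>.\<close>
    have "path_graph (Suc k) \<in> ?A k"
      by (simp add: pair_graph_path_graph connected_path_graph num_edges_path_graph)
    then show "ereal (ln ((3 + sqrt 5) / 8)) \<le> ?s k"
      using h_path_graph_ge[of "Suc k"] by (intro SUP_upper2) auto
  qed
qed

end
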